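(* Fix an integer $r\ge 1$. Let $(A_j)_{j\ge 1}$ be any infinite sequence of transition matrices of type $r$ random walks (on finite Abelian groups $G_j$, with $|G_j|\to\infty$ allowed). Then the family $(A_j)$ does not have sharp cut off; that is, there exists $\epsilon\in(0,\tfrac12)$ such that $\dfrac{t_{A_j}(\epsilon)}{t_{A_j}(1-\epsilon)}$ does not converge to $1$ as $j\to\infty$.
   Context: A random walk on a finite Abelian group $G$ is of type $r$ if $|G|\ge \pi^r$ and there are elements $a_1,\dots,a_r\in G$ (generating $G$, so the walk is irreducible) such that at each step the walk moves from $x$ to $x+s$, where $s$ is chosen uniformly from the $2r+1$ steps $+a_1,-a_1,\dots,+a_r,-a_r,0$ (each with probability $\frac1{2r+1}$). Equivalently it is the simple random walk on the Cayley graph of $G$ with generating set $\{\pm a_i\}$, where staying put has the same probability as following each edge. Let $A$ be its (symmetric, irreducible) transition matrix, ${\bf v}_0$ the uniform stationary distribution ($A{\bf v}_0={\bf v}_0$, $|{\bf v}_0|_1=1$), and ${\bf x}_0$ the point mass at the identity. Define $d_A(t)=|A^t{\bf x}_0-{\bf v}_0|_1$ for integers $t\ge0$ and $t_A(d)=\max\{t : d_A(t)\ge d\}$. A family $(A_j)$ of irreducible symmetric Markov matrices has sharp cut off if $\lim_{j\to\infty} t_{A_j}(\epsilon)/t_{A_j}(1-\epsilon)=1$ for every $\epsilon\in(0,\tfrac12)$. *)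

theory Defs
  imports "HOL-Analysis.Analysis" "HOL-Algebra.Generated_Groups"
begin

text \<open>Transition matrix of the type r walk on the finite abelian group G (written
multiplicatively, HOL-Algebra) with generators a 0, ..., a (r-1): entry M x y is the
probability of moving from y to x. Steps are counted with multiplicity (each of the
2r+1 steps has probability 1/(2r+1)).\<close>
definition walk_matrix :: "('a, 'b) monoid_scheme \<Rightarrow> nat \<Rightarrow> (nat \<Rightarrow> 'a) \<Rightarrow> 'a \<Rightarrow> 'a \<Rightarrow> real" where
  "walk_matrix G r a = (\<lambda>x y.
     ((if x = y then 1 else 0)
      + (\<Sum>i<r. (if x = y \<otimes>\<^bsub>G\<^esub> a i then 1 else 0)
                + (if x = y \<otimes>\<^bsub>G\<^esub> inv\<^bsub>G\<^esub> (a i) then 1 else 0)))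
     / real (2 * r + 1))"

definition mat_act :: "'a set \<Rightarrow> ('a \<Rightarrow> 'a \<Rightarrow> real) \<Rightarrow> ('a \<Rightarrow> real) \<Rightarrow> ('a \<Rightarrow> real)" where
  "mat_act S M v = (\<lambda>x. \<Sum>y\<in>S. M x y * v y)"

definition dist_unif :: "'a set \<Rightarrow> ('a \<Rightarrow> 'a \<Rightarrow> real) \<Rightarrow> 'a \<Rightarrow> nat \<Rightarrow> real" where
  "dist_unif S M x0 t =
     (\<Sum>x\<in>S. \<bar>((mat_act S M) ^^ t) (\<lambda>y. if y = x0 then 1 else 0) x - 1 / real (card S)\<bar>)"

definition mix_time :: "'a set \<Rightarrow> ('a \<Rightarrow> 'a \<Rightarrow> real) \<Rightarrow> 'a \<Rightarrow> real \<Rightarrow> nat" where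
  "mix_time S M x0 d = Max {t. dist_unif S M x0 t \<ge> d}"

definition sharp_cutoff ::
  "(nat \<Rightarrow> 'a set) \<Rightarrow> (nat \<Rightarrow> 'a \<Rightarrow> 'a \<Rightarrow> real) \<Rightarrow> (nat \<Rightarrow> 'a) \<Rightarrow> bool" where
  "sharp_cutoff S M x0 \<longleftrightarrow>
     (\<forall>\<epsilon>::real. 0 < \<epsilon> \<and> \<epsilon> < 1/2 \<longrightarrow>
        (\<lambda>j. real (mix_time (S j) (M j) (x0 j) \<epsilon>) / real (mix_time (S j) (M j) (x0 j) (1 - \<epsilon>)))
          \<longlonglongrightarrow> 1)"

end

(*
  On the abelian group the walk is diagonalised by characters, with eigenvalues
  (1 + 2 (cos theta_1 + ... + cos theta_r)) / (2 r + 1), where exp(i theta_k) is the value of the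
  character at a_k. Let rho < 1 be the largest modulus of a nontrivial eigenvalue. Testing against
  the corresponding character gives d(t) >= rho^t, and the l^2 distance after one step forces
  rho >= 1 / (2 r + 1), because one step reaches fewer than |G| points; so d(t) >= exp (- (2 r + 1) t (1 - rho)).
  Conversely d(t)^2 <= sum of lambda^(2 t) over nontrivial lambda. Two distinct angle vectors theta
  cannot be within delta = sqrt (2 (1 - rho)) of each other in every coordinate, since the quotient
  character would have an eigenvalue above rho. So the vectors occupy different cells of a grid
  of mesh delta, and comparison with a product of geometric series gives d(t) < 1/2 as soon as
  t (1 - rho) >= C for a constant C = C(r). Hence t(1 - eps) < C / (1 - rho), while
  t(eps) >= 2 t(1 - eps) once eps = exp (- 2 C (2 r + 1)).

  To avoid constructing the characters of G, functions on G are pulled back along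
  k |-> a_1^k_1 ... a_r^k_r to the box {0..<|G|}^r, where Fourier analysis is explicit.
*)
theory Submission
  imports Defs "HOL-Algebra.Multiplicative_Group"
begin

section \<open>Real inequalities\<close>

lemma exp_minus_less_half:
  fixes x :: real
  assumes "1 \<le> x"
  shows "exp (- x) < 1 / 2"
proof -
  have "exp (ln 2) < exp x"
    using ln_2_less_1 assms by (simp only: exp_less_cancel_iff)
  thus ?thesis by (simp add: exp_minus field_simps)
qed

lemma one_minus_cos_le: "1 - cos x \<le> x\<^sup>2 / 2" for x :: real
proof -
  have "1 - cos x = 2 * (sin (x / 2))\<^sup>2" using cos_double_sin[of "x / 2"] by simp
  also have "\<dots> \<le> 2 * (x / 2)\<^sup>2" 
    by (intro mult_left_mono) (simp_all only: abs_sin_x_le_abs_x abs_le_square_iff[symmetric] zero_le_numeral)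
  finally show ?thesis by (simp add: power2_eq_square)
qed

text \<open>Fourth-order Taylor expansion: as x^2 is at most 21/2 here, the quartic term is at most
  7/16 of x^2, leaving 1/2 - 7/16 = 1/16.\<close>

lemma one_minus_cos_ge:
  fixes x :: real
  assumes "\<bar>x\<bar> \<le> pi"
  shows "x\<^sup>2 / 16 \<le> 1 - cos x"
proof -
  obtain t where t: "cos x = (\<Sum>m<4. cos_coeff m * x ^ m) + cos (t + 1/2 * real 4 * pi) / fact 4 * x ^ 4"
    using Maclaurin_cos_expansion[of x 4] by auto
  have "(\<Sum>m<4. cos_coeff m * x ^ m) = 1 - x\<^sup>2 / 2"
    by (simp add: cos_coeff_def lessThan_nat_numeral lessThan_Suc fact_numeral)
  moreover have "cos (t + 1/2 * real 4 * pi) / fact 4 * x ^ 4 \<le> 1 / fact 4 * x ^ 4"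
    by (intro mult_right_mono divide_right_mono) auto
  ultimately have "cos x \<le> 1 - x\<^sup>2 / 2 + x ^ 4 / 24"
    using t by (simp add: fact_numeral)
  moreover have "x\<^sup>2 \<le> (21/2 :: real)"
  proof -
    have "pi \<le> 3.2" by (rule order_trans[OF pi_approx(2)]) simp
    hence "\<bar>x\<bar> \<le> 3.2" using assms by (rule order_trans[rotated])
    hence "\<bar>x\<bar>\<^sup>2 \<le> 3.2\<^sup>2" by (rule power_mono) simp
    thus ?thesis by (simp add: power2_eq_square)
  qed
  hence "x\<^sup>2 * x\<^sup>2 \<le> 21/2 * x\<^sup>2" by (rule mult_right_mono) simp
  hence "x ^ 4 / 24 \<le> 7/16 * x\<^sup>2" by (simp add: power2_eq_square power4_eq_xxxx)
  ultimately show ?thesis by linarith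
qed

text \<open>Two-sided geometric series, truncated because the later sum over grid cells is
  finite.\<close>

lemma sum_half_power_abs: "(\<Sum>z\<in>{- int B..int B}. (1/2 :: real) ^ nat \<bar>z\<bar>) = 3 - 2 * (1/2) ^ B"
proof (induction B)
  case (Suc B)
  have "{- int (Suc B)..int (Suc B)} = insert (int (Suc B)) (insert (- int (Suc B)) {- int B..int B})"
    by auto
  moreover have "nat (1 + int B) = Suc B" "nat (int B + 1) = Suc B" by simp_all
  ultimately show ?case using Suc by simp
qed simp

text \<open>The integer z, the floor of x or (for negative x) minus the floor minus 1, is
  nonnegative and at most |x|, and z \<le> z^2 for integers; the loss of 1 comes from negative x.
  This turns Gaussian decay in an angle into geometric decay in the index of its cell.\<close>

lemma square_ge_abs_floor: "real_of_int \<bar>\<lfloor>x\<rfloor>\<bar> - 1 \<le> x\<^sup>2" for x :: real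
proof -
  show ?thesis
  proof (cases "x \<ge> 0")
    case True
    let ?z = "\<lfloor>x\<rfloor>"
    have "?z \<ge> 0" using True by simp
    hence "?z * 1 \<le> ?z * ?z" by (cases "?z = 0", simp, intro mult_left_mono, linarith+)
    hence "real_of_int ?z \<le> of_int ?z * of_int ?z" by (metis mult.right_neutral of_int_le_iff of_int_mult)
    also have "\<dots> \<le> x * x" using True by (intro mult_mono) auto
    finally show ?thesis using \<open>?z \<ge> 0\<close> by (simp add: power2_eq_square)
  next
    case False
    let ?z = "- \<lfloor>x\<rfloor> - 1"
    have z: "?z \<ge> 0" "of_int ?z \<le> - x"
      using False by linarith+
    hence "?z * 1 \<le> ?z * ?z" by (cases "?z = 0", simp, intro mult_left_mono, linarith+)
    hence "real_of_int ?z \<le> of_int ?z * of_int ?z" by (metis mult.right_neutral of_int_le_iff of_int_mult)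
    also have "\<dots> \<le> (- x) * (- x)"
    proof -
      have "0 \<le> real_of_int ?z" using z(1) by linarith
      thus ?thesis using z(2) by (intro mult_mono) linarith+
    qed
    finally have "real_of_int ?z \<le> x\<^sup>2" by (simp add: power2_eq_square)
    thus ?thesis using z(1) by linarith
  qed
qed

section \<open>Fourier analysis of the walk\<close>

locale abelian_walk = comm_group G for G :: "('a, 'b) monoid_scheme" (structure) +
  fixes r :: nat and a :: "nat \<Rightarrow> 'a"
  assumes fin: "finite (carrier G)"
    and gen_closed: "i < r \<Longrightarrow> a i \<in> carrier G"
    and gen: "generate G (a ` {..<r}) = carrier G"
begin

section \<open>The box of exponent vectors modulo n and its characters\<close>

abbreviation (input) n :: nat where "n \<equiv> card (carrier G)"

text \<open>Representatives of (Z/n)^r. The modulus n = |G| serves for every coordinate, since the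
  order of each \<open>a i\<close> divides it.\<close>

definition grid :: "(nat \<Rightarrow> int) set" where
  "grid = PiE {..<r} (\<lambda>_. {0..<int n})"

definition red :: "(nat \<Rightarrow> int) \<Rightarrow> nat \<Rightarrow> int" where
  "red k = restrict (\<lambda>i. k i mod int n) {..<r}"

definition word :: "(nat \<Rightarrow> int) \<Rightarrow> 'a" where
  "word k = finprod G (\<lambda>i. a i [^] k i) {..<r}"

definition zeta :: "int \<Rightarrow> complex" where
  "zeta j = cis (2 * pi * of_int j / n)"

definition chi :: "(nat \<Rightarrow> int) \<Rightarrow> (nat \<Rightarrow> int) \<Rightarrow> complex" where
  "chi u k = zeta (\<Sum>i<r. u i * k i)"

text \<open>Mean of the character indexed by \<open>u\<close> over the 2r+1 steps, hence its
  eigenvalue.\<close>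

definition eig :: "(nat \<Rightarrow> int) \<Rightarrow> real" where
  "eig u = (1 + 2 * (\<Sum>i<r. Re (zeta (u i)))) / real (2 * r + 1)"

definition law :: "nat \<Rightarrow> 'a \<Rightarrow> real" where
  "law t = ((mat_act (carrier G) (walk_matrix G r a)) ^^ t) (\<lambda>y. if y = \<one> then 1 else 0)"

lemma n_pos: "n > 0"
  using fin by (simp add: card_gt_0_iff carrier_not_empty)

lemma finite_grid: "finite grid"
  unfolding grid_def by (intro finite_PiE) auto

lemma card_grid: "card grid = n ^ r"
  unfolding grid_def by (simp add: card_PiE)

lemma red_in_grid: "red k \<in> grid"
  using n_pos unfolding red_def grid_def by auto

lemma red_grid: "k \<in> grid \<Longrightarrow> red k = k"
  unfolding red_def grid_def by (auto simp: fun_eq_iff PiE_def Pi_def extensional_def)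

lemma zeta_add: "zeta (x + y) = zeta x * zeta y"
  unfolding zeta_def by (simp add: cis_mult add_divide_distrib distrib_left)

lemma zeta_diff: "zeta (x - y) = zeta x * cnj (zeta y)"
  unfolding zeta_def by (simp add: cis_mult cis_cnj diff_divide_distrib right_diff_distrib)

lemma zeta_0 [simp]: "zeta 0 = 1"
  unfolding zeta_def by simp

lemma norm_zeta [simp]: "cmod (zeta x) = 1"
  unfolding zeta_def by simp

lemma zeta_minus: "zeta (- x) = cnj (zeta x)"
  unfolding zeta_def by (simp add: cis_cnj)

lemma zeta_eq_1_iff: "zeta x = 1 \<longleftrightarrow> int n dvd x"
proof
  assume "zeta x = 1"
  hence "cos (2 * pi * of_int x / n) = 1"
    unfolding zeta_def by (metis Re_complex_of_real cis.sel(1) of_real_1)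
  then obtain k :: int where "2 * pi * of_int x / n = of_int k * 2 * pi"
    using cos_one_2pi_int by blast
  hence "real_of_int x = of_int (k * int n)"
    using n_pos by (simp add: field_simps)
  hence "x = k * int n" by linarith
  thus "int n dvd x" by simp
next
  assume "int n dvd x"
  then obtain k where "x = int n * k" by blast
  thus "zeta x = 1"
    using n_pos cis_multiple_2pi[of "of_int k"] unfolding zeta_def by (simp add: mult_ac)
qed

lemma zeta_cong: assumes "int n dvd x - y" shows "zeta x = zeta y"
proof -
  have "zeta (x - y) = 1" using assms zeta_eq_1_iff by blast
  thus ?thesis using zeta_add[of "x - y" y] by simp
qed

lemma chi_commute: "chi u k = chi k u"
  unfolding chi_def by (simp add: mult.commute)

lemma chi_add: "chi u (\<lambda>i. k i + l i) = chi u k * chi u l"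
  unfolding chi_def by (simp add: zeta_add[symmetric] sum.distrib distrib_left)

lemma chi_diff: "chi u (\<lambda>i. k i - l i) = chi u k * cnj (chi u l)"
  unfolding chi_def by (simp add: zeta_diff[symmetric] sum_subtractf right_diff_distrib)

lemma norm_chi [simp]: "cmod (chi u k) = 1"
  unfolding chi_def by simp

lemma chi_red: "chi u (red k) = chi u k"
  unfolding chi_def
proof (rule zeta_cong)
  have "(\<Sum>i<r. u i * red k i) - (\<Sum>i<r. u i * k i) = (\<Sum>i<r. u i * (k i mod int n - k i))"
    unfolding red_def by (simp add: sum_subtractf right_diff_distrib)
  also have "int n dvd \<dots>"
    by (intro dvd_sum dvd_mult) (simp add: mod_eq_dvd_iff[symmetric])
  finally show "int n dvd (\<Sum>i<r. u i * red k i) - (\<Sum>i<r. u i * k i)" .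
qed

definition axis :: "nat \<Rightarrow> nat \<Rightarrow> int" where
  "axis i = (\<lambda>j. if j = i then 1 else 0)"

lemma chi_axis: "i < r \<Longrightarrow> chi u (axis i) = zeta (u i)"
  unfolding chi_def axis_def by (simp add: if_distrib cong: if_cong)

section \<open>The homomorphism from exponent vectors onto the group\<close>

lemma word_closed [simp]: "word k \<in> carrier G"
  unfolding word_def by (intro finprod_closed) (auto simp: gen_closed)

lemma word_add: "word (\<lambda>i. k i + l i) = word k \<otimes> word l"
proof -
  have "word (\<lambda>i. k i + l i) = finprod G (\<lambda>i. a i [^] k i \<otimes> a i [^] l i) {..<r}"
    unfolding word_def by (intro finprod_cong') (auto simp: gen_closed int_pow_mult)
  thus ?thesis
    unfolding word_def by (simp add: finprod_multf Pi_def gen_closed)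
qed

text \<open>By Lagrange the n-th power of \<open>a i\<close> is the identity.\<close>

lemma word_red: "word (red k) = word k"
  unfolding word_def
proof (intro finprod_cong')
  fix i assume "i \<in> {..<r}"
  hence i: "i < r" and ai: "a i \<in> carrier G" using gen_closed by auto
  have o: "a i [^] int n = \<one>"
    using ai fin pow_order_eq_1[of "a i"] by (simp add: int_pow_int order_def)
  have "a i [^] k i = a i [^] (int n * (k i div int n) + k i mod int n)" by simp
  also have "\<dots> = a i [^] (int n * (k i div int n)) \<otimes> a i [^] (k i mod int n)"
    using ai int_pow_mult by blast
  also have "a i [^] (int n * (k i div int n)) = \<one>"
    using ai o by (metis int_pow_pow int_pow_one)
  finally show "a i [^] red k i = a i [^] k i"
    using ai i by (simp add: red_def)
qed (auto simp: gen_closed)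

lemma word_0: "word (\<lambda>_. 0) = \<one>"
  unfolding word_def by (simp add: finprod_one_eqI)

lemma word_minus: "word (\<lambda>i. - k i) = inv (word k)"
proof -
  have "word (\<lambda>i. - k i) \<otimes> word k = \<one>"
    using word_add[of "\<lambda>i. - k i" k] word_0 by simp
  thus ?thesis using inv_equality[of "word (\<lambda>i. - k i)" "word k"] by simp
qed

lemma word_axis: assumes "i < r" shows "word (axis i) = a i"
proof -
  have "word (axis i) = finprod G (\<lambda>j. if i = j then a j else \<one>) {..<r}"
    unfolding word_def axis_def by (intro finprod_cong') (auto simp: gen_closed)
  also have "\<dots> = a i"
    using assms by (subst finprod_singleton) (auto simp: gen_closed)
  finally show ?thesis .
qed

text \<open>The range of \<open>word\<close> is a subgroup containing the generators;
  \<open>word_red\<close> then moves the exponents into the box.\<close>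

lemma word_surj: "word ` grid = carrier G"
proof
  have "subgroup (range word) G"
  proof (rule subgroupI)
    show "range word \<subseteq> carrier G" by auto
    show "range word \<noteq> {}" by auto
    show "inv x \<in> range word" if x: "x \<in> range word" for x
    proof -
      obtain k where "x = word k" using x by blast
      thus ?thesis using word_minus[of k] by (metis rangeI)
    qed
    show "x \<otimes> y \<in> range word" if xy: "x \<in> range word" "y \<in> range word" for x y
    proof -
      obtain k l where "x = word k" "y = word l" using xy by blast
      thus ?thesis using word_add[of k l] by (metis rangeI)
    qed
  qed
  moreover have "a ` {..<r} \<subseteq> range word"
    using word_axis by (auto simp: image_subset_iff) (metis rangeI)
  ultimately have "carrier G \<subseteq> range word"
    using generate_subgroup_incl gen by metis
  also have "\<dots> \<subseteq> word ` grid"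
  proof
    fix x assume "x \<in> range word"
    then obtain k where "x = word k" by blast
    thus "x \<in> word ` grid" using word_red[of k] red_in_grid[of k] by (metis imageI)
  qed
  finally show "carrier G \<subseteq> word ` grid" .
qed auto

text \<open>Translation followed by reduction is injective on the finite box, hence permutes it.
  This stands in for translation invariance on (Z/n)^r.\<close>

lemma sum_grid_shift:
  fixes F :: "(nat \<Rightarrow> int) \<Rightarrow> 'c :: comm_monoid_add"
  assumes "\<And>k. F (red k) = F k"
  shows "(\<Sum>k\<in>grid. F (\<lambda>i. k i + l i)) = (\<Sum>k\<in>grid. F k)"
proof -
  let ?s = "\<lambda>k. red (\<lambda>i. k i + l i)"
  have "inj_on ?s grid"
  proof (rule inj_onI)
    fix k k' assume kk: "k \<in> grid" "k' \<in> grid" and eq: "?s k = ?s k'"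
    have "red k i = red k' i" for i
    proof (cases "i < r")
      case True
      hence "(k i + l i) mod int n = (k' i + l i) mod int n"
        using fun_cong[OF eq, of i] by (simp add: red_def)
      hence "k i mod int n = k' i mod int n"
        by (simp add: mod_eq_dvd_iff)
      thus ?thesis using True by (simp add: red_def)
    qed (simp add: red_def)
    thus "k = k'" using kk red_grid by (metis ext)
  qed
  moreover have "?s ` grid \<subseteq> grid" using red_in_grid by auto
  ultimately have "bij_betw ?s grid grid"
    using finite_grid by (simp add: bij_betw_def endo_inj_surj)
  hence "(\<Sum>k\<in>grid. F (?s k)) = (\<Sum>k\<in>grid. F k)"
    by (rule sum.reindex_bij_betw)
  thus ?thesis by (simp add: assms)
qed

text \<open>Indices \<^term>\<open>u\<close> whose character of the box descends to \<^term>\<open>G\<close>.\<close>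
definition dual :: "(nat \<Rightarrow> int) set" where
  "dual = {u \<in> grid. \<forall>k. word k = \<one> \<longrightarrow> chi u k = 1}"

section \<open>Fibres of \<open>word\<close>, orthogonality and Parseval on the box\<close>

definition origin :: "nat \<Rightarrow> int" where
  "origin = red (\<lambda>_. 0)"

text \<open>Order of the kernel of \<open>word\<close> on the box, and by \<open>sum_word\<close>
  the size of every fibre.\<close>

definition mult :: nat where
  "mult = card {k \<in> grid. word k = \<one>}"

definition fourier :: "('a \<Rightarrow> real) \<Rightarrow> (nat \<Rightarrow> int) \<Rightarrow> complex" where
  "fourier g u = (\<Sum>k\<in>grid. of_real (g (word k)) * chi u k)"

lemma word_add_axis: "i < r \<Longrightarrow> word (\<lambda>j. k j + axis i j) = word k \<otimes> a i"
  using word_add[of k "axis i"] word_axis by simp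

lemma word_diff: "word (\<lambda>j. k j - l j) = word k \<otimes> inv (word l)"
  using word_add[of k "\<lambda>j. - l j"] word_minus[of l] by simp

text \<open>Every fibre of \<open>word\<close> is a translate of its kernel, so all fibres have the
  same size.\<close>

lemma sum_word:
  fixes g :: "'a \<Rightarrow> 'c :: comm_semiring_1"
  shows "(\<Sum>k\<in>grid. g (word k)) = of_nat mult * (\<Sum>x\<in>carrier G. g x)"
proof -
  have fib: "card {k \<in> grid. word k = x} = mult" if x: "x \<in> carrier G" for x
  proof -
    obtain l where l: "x = word l" using word_surj x by blast
    let ?F = "\<lambda>k. if word k = \<one> then 1 else 0 :: nat"
    have *: "word (\<lambda>i. k i + - l i) = \<one> \<longleftrightarrow> word k = x" for k
      using word_diff[of k l] l inv_equality[of "word k" "inv x"] x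
      by (auto simp: r_inv)
    have "card {k \<in> grid. word k = x} = (\<Sum>k\<in>grid. ?F (\<lambda>i. k i + - l i))"
      unfolding * using finite_grid by (simp add: sum.If_cases Int_def)
    also have "\<dots> = (\<Sum>k\<in>grid. ?F k)"
      by (rule sum_grid_shift) (simp add: word_red)
    also have "\<dots> = mult"
      unfolding mult_def using finite_grid by (simp add: sum.If_cases Int_def)
    finally show ?thesis .
  qed
  have "(\<Sum>k\<in>grid. g (word k)) = (\<Sum>x\<in>carrier G. \<Sum>k | k \<in> grid \<and> word k = x. g (word k))"
    using finite_grid fin by (intro sum.group[symmetric]) auto
  also have "\<dots> = (\<Sum>x\<in>carrier G. of_nat mult * g x)"
    by (intro sum.cong refl) (simp add: fib)
  finally show ?thesis by (simp add: sum_distrib_left)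
qed

lemma card_grid_mult: "n ^ r = mult * n"
  using sum_word[of "\<lambda>_. 1 :: nat"] card_grid by simp

lemma mult_pos: "mult > 0"
  using card_grid_mult n_pos by (metis gr0I mult_0 not_gr_zero zero_less_power)

text \<open>If n does not divide \<open>l i\<close>, shifting \<open>u\<close> along axis i
  multiplies the sum by \<open>zeta (l i)\<close>, which is not 1, so the sum vanishes.\<close>

lemma sum_chi:
  "(\<Sum>u\<in>grid. chi u l) = (if \<forall>i<r. int n dvd l i then of_nat n ^ r else 0)"
proof (cases "\<forall>i<r. int n dvd l i")
  case True
  hence "chi u l = 1" for u
    unfolding chi_def zeta_eq_1_iff by (intro dvd_sum) auto
  thus ?thesis using True by (simp add: card_grid)
next
  case False
  then obtain i where i: "i < r" "\<not> int n dvd l i" by blast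
  have "(\<Sum>u\<in>grid. chi u l) = (\<Sum>u\<in>grid. chi (\<lambda>j. u j + axis i j) l)"
    by (rule sum_grid_shift[symmetric]) (metis chi_commute chi_red)
  also have "\<dots> = (\<Sum>u\<in>grid. chi u l) * zeta (l i)"
    using i chi_axis by (simp add: chi_commute[of _ l] chi_add sum_distrib_right)
  finally have "(\<Sum>u\<in>grid. chi u l) = 0"
    using i zeta_eq_1_iff by simp
  thus ?thesis unfolding if_not_P[OF False] .
qed

text \<open>Once the square is expanded and \<open>u\<close> is summed first, orthogonality keeps
  only the diagonal, because distinct points of the box are incongruent modulo n
  (\<open>eq\<close>).\<close>

lemma parseval:
  "(\<Sum>u\<in>grid. (cmod (\<Sum>k\<in>grid. c k * chi u k))\<^sup>2) = real n ^ r * (\<Sum>k\<in>grid. (cmod (c k))\<^sup>2)"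
proof -
  have eq: "(\<forall>i<r. int n dvd k i - l i) \<longleftrightarrow> l = k" if "k \<in> grid" "l \<in> grid" for k l
  proof
    assume "\<forall>i<r. int n dvd k i - l i"
    hence "red l = red k" by (auto simp: red_def fun_eq_iff mod_eq_dvd_iff dvd_diff_commute)
    thus "l = k" using that red_grid by metis
  qed simp
  have "complex_of_real (\<Sum>u\<in>grid. (cmod (\<Sum>k\<in>grid. c k * chi u k))\<^sup>2)
      = (\<Sum>u\<in>grid. \<Sum>k\<in>grid. \<Sum>l\<in>grid. c k * cnj (c l) * chi u (\<lambda>i. k i - l i))"
    by (simp add: complex_norm_square chi_diff sum_product mult_ac del: of_real_power)
  also have "\<dots> = (\<Sum>k\<in>grid. \<Sum>u\<in>grid. \<Sum>l\<in>grid. c k * cnj (c l) * chi u (\<lambda>i. k i - l i))"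
    by (rule sum.swap)
  also have "\<dots> = (\<Sum>k\<in>grid. \<Sum>l\<in>grid. c k * cnj (c l) * (\<Sum>u\<in>grid. chi u (\<lambda>i. k i - l i)))"
    by (rule sum.cong[OF refl], subst sum.swap) (simp add: sum_distrib_left)
  also have "\<dots> = (\<Sum>k\<in>grid. \<Sum>l\<in>grid. if l = k then c k * cnj (c l) * of_nat n ^ r else 0)"
    by (intro sum.cong refl) (simp add: sum_chi eq)
  also have "\<dots> = (\<Sum>k\<in>grid. c k * cnj (c k) * of_nat n ^ r)"
    using finite_grid by simp
  also have "\<dots> = complex_of_real (real n ^ r * (\<Sum>k\<in>grid. (cmod (c k))\<^sup>2))"
    by (simp add: complex_norm_square[symmetric] sum_distrib_left mult_ac)
  finally show ?thesis using of_real_eq_iff by blast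
qed

section \<open>The law of the walk under the Fourier transform\<close>

lemma law_0: "law 0 x = (if x = \<one> then 1 else 0)"
  unfolding law_def by simp

lemma law_Suc:
  assumes x: "x \<in> carrier G"
  shows "law (Suc t) x = (law t x + (\<Sum>i<r. law t (x \<otimes> inv (a i)) + law t (x \<otimes> a i))) / real (2 * r + 1)"
proof -
  have 1: "(\<Sum>y\<in>carrier G. (if x = y \<otimes> a i then 1 else 0) * v y) = v (x \<otimes> inv (a i))" 
    if i: "i < r" for i and v :: "'a \<Rightarrow> real"
  proof -
    have "(\<Sum>y\<in>carrier G. (if x = y \<otimes> a i then 1 else 0) * v y)
        = (\<Sum>y\<in>carrier G. if y = x \<otimes> inv (a i) then v y else 0)"
      using gen_closed[OF i] x by (intro sum.cong refl) (auto simp: m_assoc)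
    thus ?thesis using fin x gen_closed[OF i] by simp
  qed
  have 2: "(\<Sum>y\<in>carrier G. (if x = y \<otimes> inv (a i) then 1 else 0) * v y) = v (x \<otimes> a i)" 
    if i: "i < r" for i and v :: "'a \<Rightarrow> real"
  proof -
    have "(\<Sum>y\<in>carrier G. (if x = y \<otimes> inv (a i) then 1 else 0) * v y)
        = (\<Sum>y\<in>carrier G. if y = x \<otimes> a i then v y else 0)"
      using gen_closed[OF i] x by (intro sum.cong refl) (auto simp: m_assoc)
    thus ?thesis using fin x gen_closed[OF i] by simp
  qed
  have 3: "(\<Sum>y\<in>carrier G. (if x = y then 1 else 0) * v y) = v x" for v :: "'a \<Rightarrow> real"
    using fin x by (simp add: if_distrib[of "\<lambda>c. c * _"] cong: if_cong)
  have "law (Suc t) x = (\<Sum>y\<in>carrier G. walk_matrix G r a x y * law t y)"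
    unfolding law_def by (simp add: mat_act_def)
  also have "\<dots> = ((\<Sum>y\<in>carrier G. (if x = y then 1 else 0) * law t y)
      + (\<Sum>y\<in>carrier G. \<Sum>i<r. (if x = y \<otimes> a i then 1 else 0) * law t y
           + (if x = y \<otimes> inv (a i) then 1 else 0) * law t y)) / real (2 * r + 1)"
    unfolding walk_matrix_def
    by (simp only: sum_divide_distrib[symmetric] sum.distrib[symmetric] sum_distrib_right
          distrib_right times_divide_eq_left)
  also have "(\<Sum>y\<in>carrier G. \<Sum>i<r. (if x = y \<otimes> a i then 1 else 0) * law t y
           + (if x = y \<otimes> inv (a i) then 1 else 0) * law t y)
     = (\<Sum>i<r. (\<Sum>y\<in>carrier G. (if x = y \<otimes> a i then 1 else 0) * law t y)
           + (\<Sum>y\<in>carrier G. (if x = y \<otimes> inv (a i) then 1 else 0) * law t y))"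
    by (subst sum.swap) (simp only: sum.distrib)
  also have "\<dots> = (\<Sum>i<r. law t (x \<otimes> inv (a i)) + law t (x \<otimes> a i))"
    by (intro sum.cong refl) (simp only: 1 2 lessThan_iff)
  finally show ?thesis unfolding 3 .
qed

lemma fourier_shift:
  "(\<Sum>k\<in>grid. of_real (g (word (\<lambda>j. k j - l j))) * chi u k) = chi u l * fourier g u"
proof -
  let ?F = "\<lambda>k. of_real (g (word (\<lambda>j. k j - l j))) * chi u k"
  have "(\<Sum>k\<in>grid. ?F k) = (\<Sum>k\<in>grid. ?F (\<lambda>j. k j + l j))"
    by (rule sum_grid_shift[symmetric]) (simp add: word_diff chi_red word_red)
  also have "\<dots> = chi u l * fourier g u"
    unfolding fourier_def by (simp add: chi_add sum_distrib_left mult_ac)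
  finally show ?thesis .
qed

lemma chi_minus: "chi u (\<lambda>j. - l j) = cnj (chi u l)"
  unfolding chi_def by (simp add: sum_negf zeta_minus)

text \<open>A step averages the translates of the law by the identity, \<open>a i\<close> and
  \<open>inv (a i)\<close>; \<open>fourier_shift\<close> turns them into the factors 1,
  \<open>zeta (u i)\<close> and its conjugate, whose mean is \<open>eig u\<close>.\<close>

lemma fourier_law: "fourier (law t) u = of_real (eig u ^ t) * fourier (law 0) u"
proof (induction t)
  case (Suc t)
  have A: "(\<Sum>k\<in>grid. of_real (law t (word k \<otimes> inv (a i))) * chi u k) = zeta (u i) * fourier (law t) u"
    if "i < r" for i
    using fourier_shift[of "law t" "axis i" u] that by (simp add: word_diff word_axis chi_axis)
  have B: "(\<Sum>k\<in>grid. of_real (law t (word k \<otimes> a i)) * chi u k) = cnj (zeta (u i)) * fourier (law t) u"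
    if "i < r" for i
    using fourier_shift[of "law t" "\<lambda>j. - axis i j" u] that
    by (simp add: word_add_axis chi_minus chi_axis)
  have "fourier (law (Suc t)) u = (\<Sum>k\<in>grid. (of_real (law t (word k)) * chi u k
      + (\<Sum>i<r. of_real (law t (word k \<otimes> inv (a i))) * chi u k + of_real (law t (word k \<otimes> a i)) * chi u k))
       / of_nat (2 * r + 1))"
    unfolding fourier_def
    by (intro sum.cong refl) (simp add: law_Suc distrib_right sum_distrib_right)
  also have "\<dots> = (fourier (law t) u + (\<Sum>i<r. 
        (\<Sum>k\<in>grid. of_real (law t (word k \<otimes> inv (a i))) * chi u k) 
      + (\<Sum>k\<in>grid. of_real (law t (word k \<otimes> a i)) * chi u k))) / of_nat (2 * r + 1)"
    unfolding fourier_def sum_divide_distrib[symmetric] sum.distrib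
    by (simp add: sum.swap[of _ _ grid])
  also have "\<dots> = (fourier (law t) u + (\<Sum>i<r. 
        zeta (u i) * fourier (law t) u + cnj (zeta (u i)) * fourier (law t) u)) / of_nat (2 * r + 1)"
    by (simp add: A B)
  also have "(\<Sum>i<r. zeta (u i) * fourier (law t) u + cnj (zeta (u i)) * fourier (law t) u)
     = of_real (\<Sum>i<r. 2 * Re (zeta (u i))) * fourier (law t) u"
    by (simp add: sum_distrib_right distrib_right[symmetric] complex_add_cnj)
  also have "(fourier (law t) u + of_real (\<Sum>i<r. 2 * Re (zeta (u i))) * fourier (law t) u) / of_nat (2 * r + 1)
     = of_real (eig u) * fourier (law t) u"
    unfolding eig_def by (simp add: sum_distrib_left distrib_right)
  finally show ?case using Suc by (simp add: mult_ac)
qed simp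

text \<open>The pulled-back point mass is the indicator of the kernel of \<open>word\<close>. For
  \<open>u\<close> outside \<open>dual\<close>, translation by a kernel element \<open>l\<close>
  with \<open>chi u l\<close> different from 1 fixes the pullback but multiplies the transform by
  \<open>chi u l\<close>, so the transform is zero.\<close>

lemma fourier_law_0:
  assumes "u \<in> grid"
  shows "fourier (law 0) u = (if u \<in> dual then of_nat mult else 0)"
proof (cases "u \<in> dual")
  case True
  have "fourier (law 0) u = (\<Sum>k\<in>grid. if word k = \<one> then 1 else 0)"
    unfolding fourier_def using True by (intro sum.cong refl) (auto simp: law_0 dual_def)
  thus ?thesis using True finite_grid by (simp add: sum.If_cases Int_def mult_def)
next
  case False
  then obtain l where l: "word l = \<one>" "chi u l \<noteq> 1" using assms by (auto simp: dual_def)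
  have "fourier (law 0) u = chi u l * fourier (law 0) u"
    using fourier_shift[of "law 0" l u] l by (simp add: word_diff fourier_def)
  thus ?thesis using l False by simp
qed

lemma origin_in_dual: "origin \<in> dual"
proof -
  have "chi origin k = 1" for k by (simp add: chi_def origin_def red_def)
  thus ?thesis unfolding dual_def by (simp add: origin_def red_in_grid)
qed

lemma sum_chi_grid:
  assumes "u \<in> grid" "u \<noteq> origin" shows "(\<Sum>k\<in>grid. chi u k) = 0"
proof -
  have "\<not> (\<forall>i<r. int n dvd u i)"
  proof
    assume "\<forall>i<r. int n dvd u i"
    hence "red u = origin" unfolding origin_def by (auto simp: red_def fun_eq_iff)
    thus False using assms red_grid by simp
  qed
  hence "(\<Sum>k\<in>grid. chi k u) = 0" unfolding sum_chi by (rule if_not_P)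
  thus ?thesis by (simp add: chi_commute[of u])
qed

lemma eig_origin: "eig origin = 1"
  unfolding eig_def origin_def red_def by (simp add: field_simps)

text \<open>The constant 1/n has a transform only at \<open>origin\<close>, namely n^r / n =
  \<open>mult\<close>, which cancels the eigenvalue 1 there.\<close>

lemma fourier_law_centered:
  assumes "u \<in> grid"
  shows "fourier (\<lambda>x. law t x - 1 / n) u = (if u \<in> dual - {origin} then of_real (eig u ^ t) * of_nat mult else 0)"
proof -
  have "fourier (\<lambda>x. law t x - 1 / n) u = fourier (law t) u - (\<Sum>k\<in>grid. chi u k) / n"
    unfolding fourier_def by (simp add: left_diff_distrib sum_subtractf sum_divide_distrib)
  also have "\<dots> = (if u \<in> dual - {origin} then of_real (eig u ^ t) * of_nat mult else 0)"
  proof (cases "u = origin")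
    case True
    have "chi origin k = 1" for k by (simp add: chi_def origin_def red_def)
    moreover have "of_nat (n ^ r) = (of_nat (mult * n) :: complex)" using card_grid_mult by simp
    ultimately show ?thesis using True n_pos fourier_law[of t origin] assms origin_in_dual
      by (simp add: eig_origin card_grid fourier_law_0)
  next
    case False
    thus ?thesis using assms fourier_law[of t u] by (simp add: sum_chi_grid fourier_law_0)
  qed
  finally show ?thesis .
qed

section \<open>Distances to uniform in terms of eigenvalues\<close>

lemma eig_power_le:
  assumes "u \<in> dual - {origin}"
  shows "\<bar>eig u\<bar> ^ t \<le> (\<Sum>x\<in>carrier G. \<bar>law t x - 1 / n\<bar>)"
proof -
  have u: "u \<in> grid" using assms dual_def by auto
  have "real mult * \<bar>eig u\<bar> ^ t = cmod (fourier (\<lambda>x. law t x - 1 / n) u)"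
    using assms by (simp only: fourier_law_centered[OF u] if_True) (simp add: norm_mult norm_power)
  \<comment> \<open>Characters have modulus one, so the transform is bounded by the l^1 norm of the
    pullback.\<close>
  also have "\<dots> \<le> (\<Sum>k\<in>grid. \<bar>law t (word k) - 1 / n\<bar>)"
    unfolding fourier_def
    by (rule order_trans[OF norm_sum]) (simp add: norm_mult flip: of_real_diff)
  also have "\<dots> = real mult * (\<Sum>x\<in>carrier G. \<bar>law t x - 1 / n\<bar>)"
    by (rule sum_word)
  finally show ?thesis using mult_pos by simp
qed

text \<open>Parseval for the centred law. The square of \<open>mult\<close> appears on both sides:
  once from the transform at time 0, once from the fibre size together with n^r =
  \<open>mult\<close> * n.\<close>

lemma l2_identity:
  "real n * (\<Sum>x\<in>carrier G. (law t x - 1 / n)\<^sup>2) = (\<Sum>u\<in>dual - {origin}. eig u ^ (2 * t))"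
proof -
  have nr: "real n ^ r = real mult * n" using card_grid_mult by (metis of_nat_mult of_nat_power)
  have "(\<Sum>u\<in>grid. (cmod (fourier (\<lambda>x. law t x - 1 / n) u))\<^sup>2)
     = real n ^ r * (\<Sum>k\<in>grid. (law t (word k) - 1 / n)\<^sup>2)"
    unfolding fourier_def parseval by (simp flip: of_real_diff)
  also have "(\<Sum>k\<in>grid. (law t (word k) - 1 / n)\<^sup>2) = real mult * (\<Sum>x\<in>carrier G. (law t x - 1 / n)\<^sup>2)"
    by (rule sum_word)
  also have "(\<Sum>u\<in>grid. (cmod (fourier (\<lambda>x. law t x - 1 / n) u))\<^sup>2)
     = (\<Sum>u\<in>grid. if u \<in> dual - {origin} then (real mult)\<^sup>2 * eig u ^ (2 * t) else 0)"
    by (intro sum.cong refl)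
       (simp add: fourier_law_centered norm_mult power_mult_distrib power_mult mult.commute[of 2]
          flip: of_real_power)
  also have "\<dots> = (\<Sum>u\<in>dual - {origin}. (real mult)\<^sup>2 * eig u ^ (2 * t))"
    using finite_grid by (subst sum.If_cases) (auto intro!: sum.cong simp: dual_def)
  finally have "(real mult)\<^sup>2 * (\<Sum>u\<in>dual - {origin}. eig u ^ (2 * t))
     = (real mult)\<^sup>2 * (real n * (\<Sum>x\<in>carrier G. (law t x - 1 / n)\<^sup>2))"
    by (simp add: nr sum_distrib_left power2_eq_square mult_ac)
  thus ?thesis using mult_pos by simp
qed

lemma sum_law: "(\<Sum>x\<in>carrier G. law t x) = 1"
proof -
  have "chi origin k = 1" for k by (simp add: chi_def origin_def red_def)
  hence "fourier (law t) origin = of_real (\<Sum>k\<in>grid. law t (word k))"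
    unfolding fourier_def by simp
  also have "\<dots> = of_real (real mult * (\<Sum>x\<in>carrier G. law t x))"
    by (simp only: sum_word)
  finally have "of_real (real mult * (\<Sum>x\<in>carrier G. law t x)) = complex_of_real (real mult)"
    using fourier_law[of t origin] origin_in_dual
    by (simp add: eig_origin fourier_law_0 dual_def)
  hence "real mult * (\<Sum>x\<in>carrier G. law t x) = real mult"
    using of_real_eq_iff by blast
  thus ?thesis using mult_pos by simp
qed

text \<open>By \<open>l2_identity\<close>, n times the squared Euclidean distance to uniform (the
  chi-square distance).\<close>

definition l2 :: "nat \<Rightarrow> real" where
  "l2 t = (\<Sum>u\<in>dual - {origin}. eig u ^ (2 * t))"

lemma l2_law: "l2 t = real n * (\<Sum>x\<in>carrier G. (law t x)\<^sup>2) - 1"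
proof -
  have "(\<Sum>x\<in>carrier G. (law t x - 1 / n)\<^sup>2)
     = (\<Sum>x\<in>carrier G. (law t x)\<^sup>2 - 2 * (1 / n) * law t x + (1 / n)\<^sup>2)"
    by (intro sum.cong refl) (simp add: power2_diff)
  also have "\<dots> = (\<Sum>x\<in>carrier G. (law t x)\<^sup>2) - 1 / n"
    unfolding sum.distrib sum_subtractf sum_distrib_left[symmetric] sum_law
    using n_pos by (simp add: power2_eq_square)
  finally show ?thesis
    unfolding l2_def l2_identity[symmetric] using n_pos by (simp add: right_diff_distrib)
qed

text \<open>Every summand of \<open>l2 0\<close> is 1, so this also counts the nontrivial elements
  of \<open>dual\<close>.\<close>

lemma l2_0: "l2 0 = real n - 1"
proof -
  have "(\<Sum>x\<in>carrier G. (law 0 x)\<^sup>2) = (\<Sum>x\<in>carrier G. if x = \<one> then 1 else 0)"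
    by (intro sum.cong refl) (simp add: law_0)
  thus ?thesis using fin by (simp add: l2_law)
qed

text \<open>Each value of \<^term>\<open>law 1\<close> is a natural number divided by \<open>2r + 1\<close>, so its square is at least
  \<open>1 / (2r + 1)\<close> times itself.\<close>
lemma l2_1: "real n / real (2 * r + 1) - 1 \<le> l2 1"
proof -
  have step: "law 1 x / real (2 * r + 1) \<le> (law 1 x)\<^sup>2" if "x \<in> carrier G" for x
  proof -
    have "real (2 * r + 1) * law 1 x = law 0 x + (\<Sum>i<r. law 0 (x \<otimes> inv (a i)) + law 0 (x \<otimes> a i))"
      using law_Suc[OF that, of 0] by (simp add: field_simps)
    also have "\<dots> = real ((if x = \<one> then 1 else 0) + (\<Sum>i<r. (if x \<otimes> inv (a i) = \<one> then 1 else 0)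
        + (if x \<otimes> a i = \<one> then 1 else 0)))"
      by (simp only: law_0 of_nat_add of_nat_sum if_distrib[of real] of_nat_1 of_nat_0)
    finally obtain c where c: "real (2 * r + 1) * law 1 x = real c" by blast
    have eq: "law 1 x = real c / real (2 * r + 1)" using c by (simp add: field_simps)
    have "real c \<le> (real c)\<^sup>2" by (cases c) (auto simp: power2_eq_square algebra_simps)
    thus ?thesis unfolding eq by (simp add: power2_eq_square divide_right_mono)
  qed
  have "1 / real (2 * r + 1) = (\<Sum>x\<in>carrier G. law 1 x / real (2 * r + 1))"
    by (simp add: sum_divide_distrib[symmetric] sum_law del: One_nat_def)
  also have "\<dots> \<le> (\<Sum>x\<in>carrier G. (law 1 x)\<^sup>2)" using step by (intro sum_mono)
  finally have "real n * (1 / real (2 * r + 1)) \<le> real n * (\<Sum>x\<in>carrier G. (law 1 x)\<^sup>2)"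
    by (rule mult_left_mono) simp
  thus ?thesis by (simp add: l2_law del: One_nat_def)
qed

definition l1 :: "nat \<Rightarrow> real" where
  "l1 t = (\<Sum>x\<in>carrier G. \<bar>law t x - 1 / n\<bar>)"

lemma l1_eq_dist_unif: "dist_unif (carrier G) (walk_matrix G r a) \<one> t = l1 t"
  unfolding dist_unif_def l1_def law_def ..

text \<open>Cauchy-Schwarz over the n points of the group.\<close>

lemma l1_square_le: "(l1 t)\<^sup>2 \<le> l2 t"
proof -
  have "(l1 t)\<^sup>2 \<le> (\<Sum>x\<in>carrier G. \<bar>law t x - 1 / n\<bar>\<^sup>2) * real n"
    unfolding l1_def by (rule sum_squared_le_sum_of_squares)
  thus ?thesis unfolding l2_def l2_identity[symmetric] by (simp add: mult.commute)
qed

lemma l1_0: "l1 0 = 2 * (1 - 1 / n)"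
proof -
  have "l1 0 = (\<Sum>x\<in>carrier G. \<bar>(if x = \<one> then 1 else 0) - 1 / n\<bar>)"
    unfolding l1_def law_0 ..
  also have "\<dots> = \<bar>1 - 1 / n\<bar> + (\<Sum>x\<in>carrier G - {\<one>}. 1 / n)"
    using fin by (subst sum.remove[of _ \<one>]) auto
  also have "\<dots> = 2 * (1 - 1 / n)"
    using n_pos fin by (simp add: of_nat_diff Suc_leI diff_divide_distrib carrier_not_empty)
  finally show ?thesis .
qed

section \<open>Angles of characters and bounds on the eigenvalues\<close>

lemma grid_mem: "u \<in> grid \<Longrightarrow> i < r \<Longrightarrow> u i \<in> {0..<int n}"
  unfolding grid_def by (erule PiE_mem) simp

text \<open>Sends a residue in \<open>{0..<int n}\<close> to its representative of absolute value at
  most n/2, so that angles lie in [-pi, pi], where \<open>one_minus_cos_ge\<close> applies.\<close>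

definition centred :: "int \<Rightarrow> int" where
  "centred x = (if 2 * x > int n then x - int n else x)"

definition angle :: "int \<Rightarrow> real" where
  "angle x = 2 * pi * of_int (centred x) / n"

lemma zeta_centred: "zeta (centred x) = zeta x"
  by (rule zeta_cong) (simp add: centred_def)

lemma Re_zeta_angle: "Re (zeta x) = cos (angle x)"
  using zeta_centred[of x, symmetric] by (simp add: zeta_def angle_def)

lemma Re_zeta_diff_angle: "Re (zeta (x - y)) = cos (angle x - angle y)"
proof -
  have "zeta (x - y) = zeta (centred x - centred y)"
    by (simp add: zeta_diff zeta_centred)
  thus ?thesis by (simp add: zeta_def angle_def diff_divide_distrib right_diff_distrib)
qed

lemma abs_angle_le: 
  assumes "x \<in> {0..<int n}" shows "\<bar>angle x\<bar> \<le> pi"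
proof -
  have "2 * \<bar>centred x\<bar> \<le> int n" using assms by (auto simp: centred_def)
  hence "2 * \<bar>real_of_int (centred x)\<bar> \<le> real n" by linarith
  hence "pi * (2 * \<bar>real_of_int (centred x)\<bar>) \<le> pi * real n" by (intro mult_left_mono) auto
  thus ?thesis unfolding angle_def using n_pos by (simp add: abs_mult field_simps)
qed

lemma one_minus_eig: "1 - eig u = 2 * (\<Sum>i<r. 1 - Re (zeta (u i))) / real (2 * r + 1)"
  unfolding eig_def by (simp add: sum_subtractf field_simps)

lemma Re_zeta_le_1: "Re (zeta x) \<le> 1" and Re_zeta_ge: "- 1 \<le> Re (zeta x)"
  by (simp_all add: Re_zeta_angle)

text \<open>Every cosine is at least -1; the chance of staying put supplies the distance from
  -1.\<close>

lemma eig_lower: "- eig u \<le> 1 - 2 / real (2 * r + 1)"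
proof -
  have "(\<Sum>i<r. 1 - Re (zeta (u i))) \<le> (\<Sum>i<r. 2)"
    using Re_zeta_ge by (intro sum_mono) (simp add: diff_le_eq add_increasing2 le_diff_eq, smt)
  hence "2 * (\<Sum>i<r. 1 - Re (zeta (u i))) \<le> 4 * real r" by simp
  hence "1 - eig u \<le> 4 * real r / real (2 * r + 1)"
    unfolding one_minus_eig by (rule divide_right_mono) simp
  also have "\<dots> = 2 - 2 / real (2 * r + 1)" by (simp add: field_simps)
  finally show ?thesis by simp
qed

text \<open>A nontrivial index has a coordinate strictly between 0 and n, whose cosine is below 1;
  \<open>eig_lower\<close> handles the other end of the spectrum.\<close>

lemma abs_eig_less_1:
  assumes "u \<in> dual - {origin}" shows "\<bar>eig u\<bar> < 1"
proof -
  have u: "u \<in> grid" using assms dual_def by auto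
  have "\<exists>i<r. u i \<noteq> 0"
  proof (rule ccontr)
    assume "\<not> ?thesis"
    hence "red u = origin" unfolding origin_def by (auto simp: red_def fun_eq_iff)
    thus False using assms red_grid[OF u] by simp
  qed
  then obtain i where i: "i < r" "u i \<noteq> 0" by blast
  have ui: "u i \<in> {0..<int n}" using grid_mem[OF u i(1)] .
  hence "\<not> int n dvd u i" using i zdvd_not_zless[of "u i" "int n"] by auto
  hence "zeta (u i) \<noteq> 1" using zeta_eq_1_iff by simp
  moreover have "zeta (u i) = 1" if "Re (zeta (u i)) = 1"
    using that norm_zeta[of "u i"] cmod_power2[of "zeta (u i)"] by (simp add: complex_eq_iff)
  ultimately have "Re (zeta (u i)) \<noteq> 1" by blast
  hence "0 < 1 - Re (zeta (u i))" using Re_zeta_le_1[of "u i"] by linarith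
  hence "0 < (\<Sum>i<r. 1 - Re (zeta (u i)))"
    using i Re_zeta_le_1 by (intro sum_pos2[of _ i]) auto
  hence "0 < 1 - eig u" unfolding one_minus_eig by simp
  moreover have "- eig u < 1" using eig_lower[of u] by (rule le_less_trans) simp
  ultimately show ?thesis by linarith
qed

end

section \<open>Mixing and the spectral gap\<close>

text \<open>One step reaches at most 2r+1 points, so \<open>large\<close> says that it cannot cover
  the group.\<close>

locale large_abelian_walk = abelian_walk +
  assumes r_pos: "r > 0" and large: "n > 2 * r + 1"
begin

section \<open>The largest nontrivial eigenvalue modulus\<close>

definition rho :: real where
  "rho = Max ((\<lambda>u. \<bar>eig u\<bar>) ` (dual - {origin}))"

abbreviation (input) m :: real where "m \<equiv> real (2 * r + 1)"

lemma finite_dual: "finite dual"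
  using finite_grid unfolding dual_def by simp

lemma dual_nontrivial: "dual - {origin} \<noteq> {}"
proof
  assume "dual - {origin} = {}"
  hence "l2 0 = 0" unfolding l2_def by (simp only: sum.empty)
  thus False using l2_0 large by simp
qed

lemma abs_eig_le_rho: "u \<in> dual - {origin} \<Longrightarrow> \<bar>eig u\<bar> \<le> rho"
  unfolding rho_def using finite_dual by (intro Max_ge) auto

lemma rho_attained: obtains u where "u \<in> dual - {origin}" "\<bar>eig u\<bar> = rho"
proof -
  have *: "rho \<in> (\<lambda>u. \<bar>eig u\<bar>) ` (dual - {origin})"
    unfolding rho_def using finite_dual dual_nontrivial by (intro Max_in) auto
  show ?thesis by (rule imageE[OF *]) (rule that, auto)
qed

lemma rho_less_1: "rho < 1" and rho_nonneg: "rho \<ge> 0"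
  using rho_attained abs_eig_less_1 by (metis, metis abs_ge_zero)

lemma l2_add_le: "l2 (s + t) \<le> rho ^ (2 * s) * l2 t"
  unfolding l2_def sum_distrib_left
proof (rule sum_mono)
  fix u assume u: "u \<in> dual - {origin}"
  have "eig u ^ (2 * s) \<le> rho ^ (2 * s)"
    using power_mono[OF abs_eig_le_rho[OF u], of "2 * s"] by (simp add: power_even_abs)
  thus "eig u ^ (2 * (s + t)) \<le> rho ^ (2 * s) * eig u ^ (2 * t)"
    by (simp add: distrib_left power_add mult_right_mono)
qed

text \<open>\<open>l2_1\<close> bounds \<open>l2 1\<close> below by n/m - 1, while
  \<open>l2_add_le\<close> bounds it above by rho^2 (n - 1). A positive lower bound on
  \<open>rho\<close> is what later turns rho^t into an exponential in t (1 - rho).\<close>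

lemma rho_ge: "1 / m \<le> rho"
proof -
  \<comment> \<open>After multiplication by q^2 the two sides differ by (p - q - 1)(q - 1).\<close>
  have "(1 / q)\<^sup>2 * (p - 1) \<le> p / q - 1" if "q \<ge> 1" "p \<ge> q + 1" for p q :: real
  proof -
    have "0 \<le> (p - q - 1) * (q - 1)" using that by (intro mult_nonneg_nonneg) auto
    moreover have "(p / q - 1) * q\<^sup>2 = p * q - q * q"
      using that by (simp add: left_diff_distrib power2_eq_square)
    ultimately have "p - 1 \<le> (p / q - 1) * q\<^sup>2"
      by (simp add: algebra_simps)
    thus ?thesis using that by (simp add: power_divide pos_divide_le_eq)
  qed
  from this[of m "real n"] have "(1 / m)\<^sup>2 * (real n - 1) \<le> real n / m - 1"
    using large by simp
  also have "\<dots> \<le> rho\<^sup>2 * (real n - 1)"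
    using l2_1 l2_add_le[of 1 0] l2_0 by simp
  finally have "(1 / m)\<^sup>2 \<le> rho\<^sup>2" using large by simp
  thus ?thesis using rho_nonneg by (rule power2_le_imp_le)
qed

lemma rho_power_le_l1: "rho ^ t \<le> l1 t"
  using rho_attained eig_power_le unfolding l1_def by metis

text \<open>With s the sum of 1 - cos, the eigenvalue is 2s/m away from 1 and at least 2/m away from
  -1. Since s \<le> 2r, the quantity s/(r m) is below both distances; then 1 - y \<le> exp(-y) and
  the quadratic bound on the cosine apply.\<close>

lemma abs_eig_le_exp:
  assumes u: "u \<in> grid"
  shows "\<bar>eig u\<bar> \<le> exp (- (\<Sum>i<r. (angle (u i))\<^sup>2) / (16 * real r * m))"
proof -
  define s where "s = (\<Sum>i<r. 1 - Re (zeta (u i)))"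
  have eig: "eig u = 1 - 2 * s / m" using one_minus_eig[of u] unfolding s_def by simp
  have s0: "s \<ge> 0" unfolding s_def using Re_zeta_le_1 by (intro sum_nonneg) simp
  have "s \<le> (\<Sum>i<r. 2)"
    unfolding s_def using Re_zeta_ge by (intro sum_mono) (smt (verit))
  hence s2: "s / real r \<le> 2" using r_pos by (simp add: divide_le_eq)
  have 1: "s / real r / m \<le> 2 * s / m"
  proof (rule divide_right_mono)
    have "s / real r \<le> s / 1" using r_pos s0 by (intro divide_left_mono) auto
    thus "s / real r \<le> 2 * s" using s0 by simp
  qed simp
  have 2: "s / real r / m \<le> 2 / m" using s2 by (rule divide_right_mono) simp
  have "\<bar>eig u\<bar> \<le> 1 - s / real r / m"
    using 1 2 eig eig_lower[of u] by linarith
  also have "\<dots> \<le> exp (- (s / real r / m))"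
    using exp_ge_add_one_self[of "- (s / real r / m)"] by simp
  also have "\<dots> \<le> exp (- (\<Sum>i<r. (angle (u i))\<^sup>2) / (16 * real r * m))"
  proof -
    have "(\<Sum>i<r. (angle (u i))\<^sup>2 / 16) \<le> s"
      unfolding s_def Re_zeta_angle
      using grid_mem[OF u] by (intro sum_mono one_minus_cos_ge abs_angle_le) (simp only: lessThan_iff)
    hence "(\<Sum>i<r. (angle (u i))\<^sup>2 / 16) / real r / m \<le> s / real r / m"
      by (intro divide_right_mono) auto
    thus ?thesis by (simp add: sum_divide_distrib[symmetric] mult_ac)
  qed
  finally show ?thesis .
qed

section \<open>Separation of the dual and a packing bound\<close>

definition delta :: real where
  "delta = sqrt (2 * (1 - rho))"

lemma delta_pos: "delta > 0" and delta_square: "delta\<^sup>2 = 2 * (1 - rho)"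
  unfolding delta_def using rho_less_1 by simp_all

text \<open>Otherwise the difference w is a nontrivial element of \<open>dual\<close>. Each
  coordinate adds at most delta^2 / 2 = 1 - rho to its sum of 1 - cos, so 1 - \<open>eig w\<close>
  is at most 2r/(2r+1) times 1 - rho, contradicting the maximality of \<open>rho\<close>.\<close>

lemma dual_separated:
  assumes "u \<in> dual" "v \<in> dual" and close: "\<And>i. i < r \<Longrightarrow> \<bar>angle (u i) - angle (v i)\<bar> < delta"
  shows "u = v"
proof (rule ccontr)
  assume "u \<noteq> v"
  define w where "w = red (\<lambda>i. u i - v i)"
  have "w \<in> grid" unfolding w_def by (rule red_in_grid)
  moreover have "chi w k = 1" if "word k = \<one>" for k
  proof -
    have "chi w k = chi k u * cnj (chi k v)"
      unfolding w_def by (simp add: chi_commute[of _ k] chi_red chi_diff)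
    thus ?thesis using assms that by (simp add: dual_def chi_commute[of k])
  qed
  moreover have "w \<noteq> origin"
  proof
    assume w: "w = origin"
    have "red u = red v"
    proof
      fix i show "red u i = red v i"
        using fun_cong[OF w, of i] by (cases "i < r") (auto simp: w_def origin_def red_def mod_eq_dvd_iff)
    qed
    thus False using \<open>u \<noteq> v\<close> assms red_grid by (auto simp: dual_def)
  qed
  ultimately have "w \<in> dual - {origin}" by (simp add: dual_def)
  hence "eig w \<le> rho" using abs_eig_le_rho[of w] by linarith
  moreover have "1 - eig w < 1 - rho"
  proof -
    have "zeta (w i) = zeta (u i - v i)" if "i < r" for i
      using that by (intro zeta_cong) (simp add: w_def red_def mod_eq_dvd_iff[symmetric])
    hence "(\<Sum>i<r. 1 - Re (zeta (w i))) = (\<Sum>i<r. 1 - cos (angle (u i) - angle (v i)))"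
      by (intro sum.cong refl) (simp add: Re_zeta_diff_angle)
    also have "\<dots> \<le> (\<Sum>i<r. delta\<^sup>2 / 2)"
    proof (rule sum_mono)
      fix i assume "i \<in> {..<r}"
      hence "\<bar>angle (u i) - angle (v i)\<bar>\<^sup>2 \<le> delta\<^sup>2" using close[of i] by (intro power_mono) auto
      thus "1 - cos (angle (u i) - angle (v i)) \<le> delta\<^sup>2 / 2"
        using one_minus_cos_le[of "angle (u i) - angle (v i)"] by simp
    qed
    also have "\<dots> = real r * (1 - rho)" by (simp add: delta_square)
    finally have "1 - eig w \<le> 2 * (real r * (1 - rho)) / m"
      unfolding one_minus_eig by (intro divide_right_mono) auto
    also have "\<dots> < 1 - rho" using rho_less_1 by (simp add: field_simps)
    finally show ?thesis .
  qed
  ultimately show False by linarith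
qed

text \<open>Elements of \<open>dual\<close> lie in distinct cells of side \<open>delta\<close>, and
  on cell z the Gaussian is at most the product of the \<open>h (z i)\<close>. The sum over all
  cells in a large cube factors into r geometric series.\<close>

lemma packing_sum:
  assumes b: "b * delta\<^sup>2 \<ge> ln 2"
  shows "(\<Sum>u\<in>dual. exp (- b * (\<Sum>i<r. (angle (u i))\<^sup>2))) \<le> 8 ^ r"
proof -
  define Z where "Z u = restrict (\<lambda>i. \<lfloor>angle (u i) / delta\<rfloor>) {..<r}" for u :: "nat \<Rightarrow> int"
  \<comment> \<open>Any bound on the cell indices serves; it only keeps the index set
    finite.\<close>
  define B where "B = nat \<lceil>pi / delta\<rceil> + 1"
  \<comment> \<open>The factor 2 absorbs the loss of 1 in
    \<open>square_ge_abs_floor\<close>.\<close>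
  define h where "h z = 2 * (1/2 :: real) ^ nat \<bar>z\<bar>" for z :: int
  have inj: "inj_on Z dual"
  proof (rule inj_onI)
    fix u v assume uv: "u \<in> dual" "v \<in> dual" and eq: "Z u = Z v"
    show "u = v"
    proof (rule dual_separated[OF uv])
      fix i assume "i < r"
      hence "\<lfloor>angle (u i) / delta\<rfloor> = \<lfloor>angle (v i) / delta\<rfloor>"
        using fun_cong[OF eq, of i] by (simp add: Z_def)
      hence "\<bar>angle (u i) / delta - angle (v i) / delta\<bar> < 1" by linarith
      thus "\<bar>angle (u i) - angle (v i)\<bar> < delta"
        using delta_pos by (simp add: diff_divide_distrib[symmetric])
    qed
  qed
  have img: "Z ` dual \<subseteq> PiE {..<r} (\<lambda>_. {- int B..int B})"
  proof
    fix f assume "f \<in> Z ` dual"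
    then obtain u where u: "u \<in> grid" "f = Z u" by (auto simp: dual_def)
    have "\<lfloor>angle (u i) / delta\<rfloor> \<in> {- int B..int B}" if "i < r" for i
    proof -
      have "\<bar>angle (u i)\<bar> \<le> pi" by (intro abs_angle_le grid_mem u that)
      hence "\<bar>angle (u i) / delta\<bar> \<le> pi / delta" using delta_pos by (simp add: divide_right_mono)
      moreover have "pi / delta \<le> real B" 
        using real_nat_ceiling_ge[of "pi / delta"] unfolding B_def by simp
      ultimately have "- real B \<le> angle (u i) / delta" "angle (u i) / delta \<le> real B" by linarith+
      thus ?thesis by (simp add: le_floor_iff) linarith
    qed
    thus "f \<in> PiE {..<r} (\<lambda>_. {- int B..int B})" using u by (auto simp: Z_def)
  qed
  have term_le: "exp (- b * (angle x)\<^sup>2) \<le> h \<lfloor>angle x / delta\<rfloor>" for x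
  proof -
    let ?y = "angle x / delta"
    have "ln 2 * (real_of_int \<bar>\<lfloor>?y\<rfloor>\<bar> - 1) \<le> ln 2 * ?y\<^sup>2"
      by (intro mult_left_mono square_ge_abs_floor) simp
    also have "\<dots> \<le> b * delta\<^sup>2 * ?y\<^sup>2" using b by (intro mult_right_mono) auto
    also have "\<dots> = b * (angle x)\<^sup>2" using delta_pos by (simp add: power_divide)
    finally have "exp (- b * (angle x)\<^sup>2) \<le> exp (ln 2 - ln 2 * real (nat \<bar>\<lfloor>?y\<rfloor>\<bar>))"
      by (simp add: right_diff_distrib)
    also have "\<dots> = h \<lfloor>?y\<rfloor>"
      unfolding h_def exp_diff exp_of_nat2_mult by (simp add: power_one_over)
    finally show ?thesis .
  qed
  have "(\<Sum>u\<in>dual. exp (- b * (\<Sum>i<r. (angle (u i))\<^sup>2))) \<le> (\<Sum>u\<in>dual. \<Prod>i<r. h (Z u i))"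
  proof (rule sum_mono)
    fix u
    have "exp (- b * (\<Sum>i<r. (angle (u i))\<^sup>2)) = (\<Prod>i<r. exp (- b * (angle (u i))\<^sup>2))"
      unfolding sum_distrib_left by (rule exp_sum) simp
    also have "\<dots> \<le> (\<Prod>i<r. h (Z u i))"
      using term_le by (intro prod_mono) (simp add: Z_def)
    finally show "exp (- b * (\<Sum>i<r. (angle (u i))\<^sup>2)) \<le> (\<Prod>i<r. h (Z u i))" .
  qed
  also have "\<dots> = (\<Sum>f\<in>Z ` dual. \<Prod>i<r. h (f i))"
    by (simp add: sum.reindex[OF inj])
  also have "\<dots> \<le> (\<Sum>f\<in>PiE {..<r} (\<lambda>_. {- int B..int B}). \<Prod>i<r. h (f i))"
    using img by (intro sum_mono2 finite_PiE prod_nonneg) (auto simp: h_def)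
  also have "\<dots> = (\<Prod>i<r. \<Sum>z\<in>{- int B..int B}. h z)"
    by (subst prod_sum_PiE) auto
  also have "(\<Sum>z\<in>{- int B..int B}. h z) = 2 * (3 - 2 * (1/2) ^ B)"
    unfolding h_def sum_distrib_left[symmetric] sum_half_power_abs ..
  \<comment> \<open>Each factor is at most 6; the weaker 8 is convenient because it is the cube of
    2, later compared with the cube of e.\<close>
  also have "(\<Prod>i<r. 2 * (3 - 2 * (1/2) ^ B)) \<le> (8 :: real) ^ r"
  proof -
    have "(2 * (3 - 2 * q)) ^ r \<le> 8 ^ r" if "0 \<le> q" "q \<le> 1" for q :: real
      using that by (intro power_mono) auto
    from this[of "(1/2) ^ B"] show ?thesis by (simp add: power_le_one)
  qed
  finally show ?thesis .
qed

text \<open>With \<open>b\<close> = T/(8 r m) and delta^2 = 2 (1 - rho), the hypothesis says exactly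
  that b delta^2 \<ge> 1, which exceeds ln 2.\<close>

lemma l2_le:
  assumes T: "real T * (1 - rho) \<ge> 4 * real r * m"
  shows "l2 T \<le> 8 ^ r"
proof -
  define b where "b = 2 * real T / (16 * real r * m)"
  \<comment> \<open>Including \<open>origin\<close> only adds a nonnegative term.\<close>
  have "l2 T \<le> (\<Sum>u\<in>dual. \<bar>eig u\<bar> ^ (2 * T))"
    unfolding l2_def using finite_dual by (subst power_even_abs[symmetric]) (auto intro!: sum_mono2)
  also have "\<dots> \<le> (\<Sum>u\<in>dual. exp (- b * (\<Sum>i<r. (angle (u i))\<^sup>2)))"
  proof (rule sum_mono)
    fix u assume "u \<in> dual"
    hence "\<bar>eig u\<bar> ^ (2 * T) \<le> exp (- (\<Sum>i<r. (angle (u i))\<^sup>2) / (16 * real r * m)) ^ (2 * T)"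
      by (intro power_mono abs_eig_le_exp) (auto simp: dual_def)
    also have "\<dots> = exp (- b * (\<Sum>i<r. (angle (u i))\<^sup>2))"
      unfolding b_def exp_of_nat_mult[symmetric] by simp
    finally show "\<bar>eig u\<bar> ^ (2 * T) \<le> exp (- b * (\<Sum>i<r. (angle (u i))\<^sup>2))" .
  qed
  also have "\<dots> \<le> 8 ^ r"
  proof (rule packing_sum)
    have "ln 2 \<le> (1 :: real)" using ln_2_less_1 by simp
    also have "\<dots> \<le> b * delta\<^sup>2"
    proof -
      have "b * delta\<^sup>2 = real T * (1 - rho) / (4 * real r * m)"
        unfolding b_def delta_square by (simp add: divide_simps) (simp add: algebra_simps)
      thus ?thesis using T r_pos by (simp add: le_divide_eq)
    qed
    finally show "ln 2 \<le> b * delta\<^sup>2" .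
  qed
  finally show ?thesis .
qed

section \<open>Upper and lower bounds on the mixing time\<close>

lemma l1_less_half:
  assumes t: "real t * (1 - rho) \<ge> 4 * real r * m + 2 * real r + 3"
  shows "l1 t < 1/2"
proof -
  \<comment> \<open>The first T steps bring \<open>l2\<close> down to 8^r and the other s steps
    contract it. Of the extra 2r+3 in the hypothesis, 1 pays for rounding T up and 2r+2 is left for
    s.\<close>
  define T where "T = nat \<lceil>4 * real r * m / (1 - rho)\<rceil>"
  have T: "4 * real r * m / (1 - rho) \<le> real T" "real T \<le> 4 * real r * m / (1 - rho) + 1"
    unfolding T_def using rho_less_1 by (simp_all add: real_nat_ceiling_ge)
  have T1: "4 * real r * m \<le> real T * (1 - rho)"
    using T(1) rho_less_1 by (simp add: pos_divide_le_eq)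
  have "real T * (1 - rho) \<le> (4 * real r * m / (1 - rho) + 1) * (1 - rho)"
    using T(2) rho_less_1 by (intro mult_right_mono) auto
  also have "\<dots> \<le> 4 * real r * m + 1"
    using rho_less_1 rho_nonneg by (simp add: distrib_right)
  finally have T2: "real T * (1 - rho) \<le> 4 * real r * m + 1" .
  hence "real T * (1 - rho) \<le> real t * (1 - rho)" using t by linarith
  hence "T \<le> t" using rho_less_1 by simp
  then obtain s where s: "t = s + T" by (metis add.commute le_Suc_ex)
  have s1: "real s * (1 - rho) \<ge> 2 * real r + 2"
    using t T2 unfolding s by (simp add: distrib_right)
  have "rho \<le> exp (- (1 - rho))"
    using exp_ge_add_one_self[of "- (1 - rho)"] by simp
  hence "rho ^ (2 * s) \<le> exp (- (1 - rho)) ^ (2 * s)"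
    using rho_nonneg by (rule power_mono)
  also have "\<dots> = exp (- 2 * (real s * (1 - rho)))"
    by (simp add: exp_of_nat_mult[symmetric]) (simp add: algebra_simps)
  also have "\<dots> \<le> exp (- 1 * real (3 * (r + 1)))"
    using s1 by simp
  also have "\<dots> = (1 / exp 1 ^ 3) ^ (r + 1)"
    by (simp only: exp_of_nat2_mult power_mult exp_minus inverse_eq_divide power_one_over)
  \<comment> \<open>From e \<ge> 2; the resulting 8^-(r+1) outweighs the 8^r from
    \<open>l2_le\<close>.\<close>
  also have "\<dots> \<le> (1 / 8) ^ (r + 1)"
  proof (intro power_mono)
    have "(2 :: real) ^ 3 \<le> exp 1 ^ 3" using exp_ge_add_one_self[of 1] by (intro power_mono) auto
    thus "1 / exp 1 ^ 3 \<le> (1 / 8 :: real)" by (intro divide_left_mono) auto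
  qed simp
  finally have "rho ^ (2 * s) \<le> (1 / 8) ^ (r + 1)" .
  hence "rho ^ (2 * s) * l2 T \<le> (1 / 8) ^ (r + 1) * 8 ^ r"
    using l2_le[OF T1] by (intro mult_mono) (auto simp: l2_def intro!: sum_nonneg)
  also have "\<dots> = 1 / 8" by (simp add: power_one_over)
  finally have "(l1 t)\<^sup>2 \<le> 1 / 8"
    using l1_square_le[of t] l2_add_le[of s T] unfolding s by linarith
  also have "\<dots> < (1/2)\<^sup>2" by (simp add: power2_eq_square)
  finally show ?thesis by (rule power2_less_imp_less) simp
qed

text \<open>ln rho \<ge> 1 - 1/rho = -(1 - rho)/rho \<ge> -m (1 - rho), the last step by
  \<open>rho_ge\<close>.\<close>

lemma exp_le_l1:
  assumes "m * (real t * (1 - rho)) \<le> L"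
  shows "exp (- L) \<le> l1 t"
proof -
  have pos: "rho > 0" using rho_ge by (rule less_le_trans[rotated]) simp
  have "1 / rho \<le> m" using rho_ge pos by (simp add: field_simps)
  hence "(1 - rho) * (1 / rho) \<le> (1 - rho) * m"
    using rho_less_1 by (intro mult_left_mono) auto
  moreover have "1 - 1 / rho \<le> ln rho" using pos ln_add_one_self_le_self2[of "1 / rho - 1"]
    by (simp add: ln_div)
  moreover have "(1 - rho) * (1 / rho) = 1 / rho - 1" using pos by (simp add: diff_divide_distrib)
  ultimately have "- (m * (1 - rho)) \<le> ln rho" by (simp only: mult.commute[of m])
  hence "real t * - (m * (1 - rho)) \<le> real t * ln rho" by (rule mult_left_mono) simp
  hence "exp (- L) \<le> exp (real t * ln rho)" using assms by (simp add: mult_ac)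
  also have "\<dots> = rho ^ t" using pos by (simp add: exp_of_nat_mult)
  finally show ?thesis using rho_power_le_l1[of t] by linarith
qed

text \<open>The squared distance is at most rho^(2t) times \<open>l2 0\<close>, which tends to 0.
  Finiteness gives the \<open>Max\<close> in \<open>mix_time\<close> its intended meaning.\<close>

lemma finite_l1_ge: assumes "d > 0" shows "finite {t. l1 t \<ge> d}"
proof -
  have "(\<lambda>t. rho ^ t * rho ^ t * l2 0) \<longlonglongrightarrow> 0 * 0 * l2 0"
    using rho_less_1 rho_nonneg by (intro tendsto_intros LIMSEQ_realpow_zero) auto
  hence "eventually (\<lambda>t. rho ^ t * rho ^ t * l2 0 < d\<^sup>2) sequentially"
    using assms by (intro order_tendstoD(2)) auto
  then obtain T where T: "\<And>t. t \<ge> T \<Longrightarrow> rho ^ t * rho ^ t * l2 0 < d\<^sup>2"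
    unfolding eventually_sequentially by blast
  have "t < T" if "l1 t \<ge> d" for t
  proof (rule ccontr)
    assume "\<not> t < T"
    hence "rho ^ (2 * t) * l2 0 < d\<^sup>2" using T[of t] by (simp add: mult_2 power_add)
    hence "(l1 t)\<^sup>2 < d\<^sup>2" using l1_square_le[of t] l2_add_le[of t 0] by simp
    moreover have "d\<^sup>2 \<le> (l1 t)\<^sup>2" using that assms by (intro power_mono) auto
    ultimately show False by simp
  qed
  hence "{t. l1 t \<ge> d} \<subseteq> {..<T}" by auto
  thus ?thesis by (rule finite_subset) simp
qed

text \<open>The first alternative is the junk case of a zero denominator, where the quotient is \<open>0\<close>.\<close>
lemma mix_time_ratio:
  fixes C \<epsilon> :: real
  defines "C \<equiv> 4 * real r * m + 2 * real r + 3"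
  defines "\<epsilon> \<equiv> exp (- (m * (2 * C)))"
  defines "\<tau> \<equiv> mix_time (carrier G) (walk_matrix G r a) \<one>"
  shows "\<tau> (1 - \<epsilon>) = 0 \<or> real (\<tau> \<epsilon>) / real (\<tau> (1 - \<epsilon>)) \<ge> 2"
proof -
  have eps: "0 < \<epsilon>" "\<epsilon> < 1/2"
  proof -
    have "1 * 1 \<le> m * (2 * C)" unfolding C_def by (intro mult_mono) auto
    thus "\<epsilon> < 1/2" unfolding \<epsilon>_def using exp_minus_less_half by simp
  qed (simp add: \<epsilon>_def)
  have tau: "\<tau> d = Max {t. l1 t \<ge> d}" for d
    unfolding \<tau>_def mix_time_def l1_eq_dist_unif ..
  have "\<tau> (1 - \<epsilon>) \<in> {t. l1 t \<ge> 1 - \<epsilon>}"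
    unfolding tau
  proof (rule Max_in)
    \<comment> \<open>At time 0 the distance is 2 (1 - 1/n) \<ge> 1, so the set is nonempty and its
      maximum is attained.\<close>
    have "real n \<ge> 2" using large by simp
    hence "1 \<le> l1 0" by (simp add: l1_0 field_simps)
    hence "1 - \<epsilon> \<le> l1 0" using eps by linarith
    thus "{t. l1 t \<ge> 1 - \<epsilon>} \<noteq> {}" by blast
  qed (use eps in \<open>simp add: finite_l1_ge\<close>)
  \<comment> \<open>The distance at this time is at least 1 - \<epsilon> > 1/2, so
    \<open>l1_less_half\<close> cannot apply.\<close>
  hence "\<not> real (\<tau> (1 - \<epsilon>)) * (1 - rho) \<ge> C"
    using l1_less_half[of "\<tau> (1 - \<epsilon>)"] eps unfolding C_def by force
  hence up: "real (\<tau> (1 - \<epsilon>)) * (1 - rho) < C" by simp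
  have "m * (real (2 * \<tau> (1 - \<epsilon>)) * (1 - rho)) \<le> m * (2 * C)"
    using up by (intro mult_left_mono) auto
  \<comment> \<open>\<epsilon> was chosen so that the distance is still at least \<epsilon> at twice
    the time \<tau>(1 - \<epsilon>).\<close>
  hence "\<epsilon> \<le> l1 (2 * \<tau> (1 - \<epsilon>))" unfolding \<epsilon>_def by (rule exp_le_l1)
  hence "2 * \<tau> (1 - \<epsilon>) \<le> \<tau> \<epsilon>"
    unfolding tau[of \<epsilon>] using finite_l1_ge eps by (intro Max_ge) auto
  hence "2 * real (\<tau> (1 - \<epsilon>)) \<le> real (\<tau> \<epsilon>)" by linarith
  thus ?thesis by (cases "\<tau> (1 - \<epsilon>) = 0") (auto simp: le_divide_eq)
qed

end

section \<open>Conclusion for sequences of type r walks\<close>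

lemma pi_power_gt:
  assumes "r \<ge> 1" shows "real (2 * r + 1) < pi ^ r"
proof -
  \<comment> \<open>Bernoulli with base 3, just below pi.\<close>
  have "1 + real r * 2 \<le> (1 + 2) ^ r" by (rule Bernoulli_inequality) simp
  also have "\<dots> < pi ^ r"
  proof (rule power_strict_mono)
    show "1 + 2 < pi" by (rule less_le_trans[OF _ pi_approx(1)]) simp
  qed (use assms in auto)
  finally show ?thesis by (simp add: mult.commute)
qed

theorem theorem1:
  fixes r :: nat
    and G :: "nat \<Rightarrow> ('a, 'b) monoid_scheme"
    and a :: "nat \<Rightarrow> nat \<Rightarrow> 'a"
  assumes "r \<ge> 1"
    and "\<And>j. comm_group (G j)"
    and "\<And>j. finite (carrier (G j))"
    and "\<And>j. real (card (carrier (G j))) \<ge> pi ^ r"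
    and "\<And>j i. i < r \<Longrightarrow> a j i \<in> carrier (G j)"
    and "\<And>j. generate (G j) (a j ` {..<r}) = carrier (G j)"
  shows "\<not> sharp_cutoff (\<lambda>j. carrier (G j)) (\<lambda>j. walk_matrix (G j) r (a j)) (\<lambda>j. \<one>\<^bsub>G j\<^esub>)"
proof
  define C where "C = 4 * real r * real (2 * r + 1) + 2 * real r + 3"
  define \<epsilon> where "\<epsilon> = exp (- (real (2 * r + 1) * (2 * C)))"
  let ?\<tau> = "\<lambda>j. mix_time (carrier (G j)) (walk_matrix (G j) r (a j)) \<one>\<^bsub>G j\<^esub>"
  let ?q = "\<lambda>j. real (?\<tau> j \<epsilon>) / real (?\<tau> j (1 - \<epsilon>))"
  \<comment> \<open>\<epsilon> depends on r alone, so one value works for every j, and no quotient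
    lies strictly between 0 and 2.\<close>
  have dichotomy: "?q j = 0 \<or> ?q j \<ge> 2" for j
  proof -
    have "2 * r + 1 < card (carrier (G j))"
      using pi_power_gt[OF assms(1)] assms(4)[of j] by linarith
    then interpret large_abelian_walk "G j" r "a j"
      using assms by (intro large_abelian_walk.intro abelian_walk.intro abelian_walk_axioms.intro
          large_abelian_walk_axioms.intro) auto
    show ?thesis
      using mix_time_ratio unfolding C_def[symmetric] \<epsilon>_def[symmetric] by auto
  qed
  have "1 * 1 \<le> real (2 * r + 1) * (2 * C)"
    unfolding C_def by (intro mult_mono) auto
  hence "0 < \<epsilon>" "\<epsilon> < 1/2"
    unfolding \<epsilon>_def using exp_minus_less_half by auto
  moreover assume "sharp_cutoff (\<lambda>j. carrier (G j)) (\<lambda>j. walk_matrix (G j) r (a j)) (\<lambda>j. \<one>\<^bsub>G j\<^esub>)"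
  ultimately have "?q \<longlonglongrightarrow> 1"
    unfolding sharp_cutoff_def by blast
  hence "eventually (\<lambda>j. 1/2 < ?q j \<and> ?q j < 3/2) sequentially"
    by (intro eventually_conj order_tendstoD) auto
  then obtain j where "1/2 < ?q j" "?q j < 3/2"
    unfolding eventually_sequentially by blast
  thus False using dichotomy[of j] by linarith
qed

end
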